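(* Let $(X,d)$ be a compact metric space and let $f:X\to X$ be a distal homeomorphism. Then the topological entropy of the induced hyperspace map $2^f:2^X\to 2^X$ is zero: $h_{top}(2^f)=0$.
   Context: $2^X$ denotes the hyperspace of all nonempty closed subsets of $X$, equipped with the Hausdorff metric $d_H(A,B)=\max\{\sup_{x\in A}d(x,B),\sup_{y\in B}d(y,A)\}$, which makes it a compact metric space. The induced map is $2^f(A)=f(A)$; it is continuous. A pair $(x,y)\in X\times X$ is distal if $\liminf_{n\to\infty} d(f^n(x),f^n(y))>0$. The homeomorphism $f$ is distal if every pair $(x,y)$ with $x\neq y$ is distal. $h_{top}$ denotes topological entropy. *)

theory Defs
  imports "HOL-Analysis.Analysis"
begin

text \<open>
  As for the library's locale \<^locale>\<open>Metric_space\<close>, a metric space is given by a carrier and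
  a distance function on it, so that the same notions apply to \<open>(X, d)\<close> and to its hyperspace
  with the Hausdorff metric.
\<close>

definition distal_pair :: "('a \<Rightarrow> 'a \<Rightarrow> real) \<Rightarrow> ('a \<Rightarrow> 'a) \<Rightarrow> 'a \<Rightarrow> 'a \<Rightarrow> bool" where
  "distal_pair d f x y \<longleftrightarrow> liminf (\<lambda>n. ereal (d ((f ^^ n) x) ((f ^^ n) y))) > 0"

definition distal_on :: "'a set \<Rightarrow> ('a \<Rightarrow> 'a \<Rightarrow> real) \<Rightarrow> ('a \<Rightarrow> 'a) \<Rightarrow> bool" where
  "distal_on X d f \<longleftrightarrow> (\<forall>x\<in>X. \<forall>y\<in>X. x \<noteq> y \<longrightarrow> distal_pair d f x y)"

definition hyperspace :: "'a set \<Rightarrow> ('a \<Rightarrow> 'a \<Rightarrow> real) \<Rightarrow> 'a set set" where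
  "hyperspace X d = {A. closedin (Metric_space.mtopology X d) A \<and> A \<noteq> {}}"

text \<open>Only meaningful for nonempty bounded sets, since suprema and infima are taken in the reals.\<close>

definition hausdorff_dist :: "('a \<Rightarrow> 'a \<Rightarrow> real) \<Rightarrow> 'a set \<Rightarrow> 'a set \<Rightarrow> real" where
  "hausdorff_dist d A B = max (SUP x\<in>A. INF y\<in>B. d x y) (SUP y\<in>B. INF x\<in>A. d y x)"

definition induced_map :: "('a \<Rightarrow> 'a) \<Rightarrow> 'a set \<Rightarrow> 'a set" where
  "induced_map f A = f ` A"

text \<open>
  Topological entropy in the sense of Bowen and Dinaburg:
  \<open>lim\<^bsub>\<epsilon>\<rightarrow>0\<^esub> limsup\<^bsub>n\<rightarrow>\<infinity>\<^esub> 1/n log s\<^sub>n(\<epsilon>)\<close>, where \<open>s\<^sub>n(\<epsilon>)\<close> is the maximal cardinality of an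
  \<open>(n, \<epsilon>)\<close>-separated subset. The supremum of the logarithms is taken over finite separated sets and
  in the extended reals, so it is \<open>\<infinity>\<close> if their cardinalities are unbounded. Since \<open>ln 0 = 0\<close>, the
  empty space has entropy 0.
\<close>

definition bowen_separated ::
  "'a set \<Rightarrow> ('a \<Rightarrow> 'a \<Rightarrow> real) \<Rightarrow> ('a \<Rightarrow> 'a) \<Rightarrow> nat \<Rightarrow> real \<Rightarrow> 'a set \<Rightarrow> bool" where
  "bowen_separated X d f n \<epsilon> E \<longleftrightarrow> E \<subseteq> X \<and>
     (\<forall>x\<in>E. \<forall>y\<in>E. x \<noteq> y \<longrightarrow> (\<exists>i<n. d ((f ^^ i) x) ((f ^^ i) y) > \<epsilon>))"

definition log_separated ::
  "'a set \<Rightarrow> ('a \<Rightarrow> 'a \<Rightarrow> real) \<Rightarrow> ('a \<Rightarrow> 'a) \<Rightarrow> nat \<Rightarrow> real \<Rightarrow> ereal" where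
  "log_separated X d f n \<epsilon> =
     (SUP E\<in>{E. finite E \<and> bowen_separated X d f n \<epsilon> E}. ereal (ln (real (card E))))"

definition entropy_at_scale ::
  "'a set \<Rightarrow> ('a \<Rightarrow> 'a \<Rightarrow> real) \<Rightarrow> ('a \<Rightarrow> 'a) \<Rightarrow> real \<Rightarrow> ereal" where
  "entropy_at_scale X d f \<epsilon> = limsup (\<lambda>n. log_separated X d f n \<epsilon> / ereal (real n))"

definition topological_entropy ::
  "'a set \<Rightarrow> ('a \<Rightarrow> 'a \<Rightarrow> real) \<Rightarrow> ('a \<Rightarrow> 'a) \<Rightarrow> ereal" where
  "topological_entropy X d f = Lim (at_right 0) (entropy_at_scale X d f)"

lemma entropy_at_scale_antimono:
  assumes "\<epsilon> \<le> \<delta>"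
  shows "entropy_at_scale X d f \<delta> \<le> entropy_at_scale X d f \<epsilon>"
  unfolding entropy_at_scale_def
proof (rule Limsup_mono, rule always_eventually, rule allI)
  fix n
  have "bowen_separated X d f n \<epsilon> E" if "bowen_separated X d f n \<delta> E" for E
    using that assms unfolding bowen_separated_def by (meson le_less_trans)
  then have "log_separated X d f n \<delta> \<le> log_separated X d f n \<epsilon>"
    unfolding log_separated_def by (intro SUP_subset_mono) auto
  then show "log_separated X d f n \<delta> / ereal (real n) \<le> log_separated X d f n \<epsilon> / ereal (real n)"
    by (cases "n = 0") (auto intro: ereal_divide_right_mono simp: divide_ereal_def
        intro!: ereal_mult_right_mono)
qed

text \<open>The limit defining the entropy always exists.\<close>

lemma tendsto_topological_entropy:
  "(entropy_at_scale X d f \<longlongrightarrow> topological_entropy X d f) (at_right 0)"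
proof -
  let ?S = "SUP \<epsilon>\<in>{0<..}. entropy_at_scale X d f \<epsilon>"
  have "(entropy_at_scale X d f \<longlongrightarrow> ?S) (at_right 0)"
  proof (rule order_tendstoI)
    fix a assume "a < ?S"
    then obtain \<delta> where \<delta>: "\<delta> > 0" "a < entropy_at_scale X d f \<delta>"
      by (auto simp: less_SUP_iff)
    have "a < entropy_at_scale X d f \<epsilon>" if "\<epsilon> < \<delta>" for \<epsilon>
      using \<delta>(2) entropy_at_scale_antimono[of \<epsilon> \<delta> X d f] that by (meson less_imp_le less_le_trans)
    then show "\<forall>\<^sub>F \<epsilon> in at_right 0. a < entropy_at_scale X d f \<epsilon>"
      using \<delta>(1) by (auto simp: eventually_at_right_field)
  next
    fix a assume "?S < a"
    then have "entropy_at_scale X d f \<epsilon> < a" if "\<epsilon> > 0" for \<epsilon>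
      using that by (meson SUP_upper greaterThan_iff le_less_trans)
    then show "\<forall>\<^sub>F \<epsilon> in at_right 0. entropy_at_scale X d f \<epsilon> < a"
      by (auto simp: eventually_at_right_field intro: exI[of _ 1])
  qed
  then show ?thesis
    unfolding topological_entropy_def by (simp add: tendsto_Lim)
qed

end

theory Submission
  imports Defs
begin

text \<open>
  Suppose that \<open>2\<^sup>f\<close> has exponentially many separated orbits. Record for a closed set \<open>A\<close> and a time
  \<open>t\<close> which balls around the points of a finite net are met by \<open>f\<^sup>t(A)\<close>, and split the orbits
  according to these tests, from the last time to the first. Exponential growth forces a branch that
  often turns to the sets missing a ball while other sets meet it. This gives a ball, a
  slightly larger ball \<open>B'\<close>, a set \<open>J\<close> of times of positive density and, for \<open>j \<in> J\<close>, a point in the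
  ball which is outside of \<open>B'\<close> at all times \<open>i - j > 0\<close>, \<open>i \<in> J\<close>. As \<open>J\<close> has positive density, it
  contains translates of all finite subsums of a sequence \<open>s\<close>, so in the limit there is a point \<open>x\<close>
  that does not return near itself at any time that is a finite sum of \<open>s\<close>. This contradicts
  distality: an idempotent limit \<open>p\<close> of the iterates along these times satisfies \<open>p (p x) = p x\<close>, so
  \<open>x\<close> and \<open>p x\<close> are proximal and \<open>p x = x\<close>.
\<close>

section \<open>Idempotents in compact right topological semigroups\<close>

text \<open>Zorn's lemma, with compactness bounding chains from below: the intersection of a chain
  of nonempty closed subsemigroups is nonempty by the finite intersection property.\<close>

lemma minimal_closed_subsemigroup:
  assumes T: "compact_space T" "topspace T \<noteq> {}"
    and closed: "\<And>x y. x \<in> topspace T \<Longrightarrow> y \<in> topspace T \<Longrightarrow> mul x y \<in> topspace T"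
  obtains S where "closedin T S" "S \<noteq> {}" "\<forall>x\<in>S. \<forall>y\<in>S. mul x y \<in> S"
    "\<forall>R. closedin T R \<and> R \<noteq> {} \<and> (\<forall>x\<in>R. \<forall>y\<in>R. mul x y \<in> R) \<and> R \<subseteq> S \<longrightarrow> R = S"
proof -
  define good where "good S \<longleftrightarrow> closedin T S \<and> S \<noteq> {} \<and> (\<forall>x\<in>S. \<forall>y\<in>S. mul x y \<in> S)" for S
  \<comment> \<open>Complements reverse the order, so that a maximal \<open>U\<close> yields a
    minimal subsemigroup.\<close>
  let ?\<U> = "{U. U \<subseteq> topspace T \<and> good (topspace T - U)}"
  have "\<exists>U\<in>?\<U>. \<forall>V\<in>?\<U>. U \<subseteq> V \<longrightarrow> V = U"
  proof (rule subset_Zorn_nonempty)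
    have "good (topspace T)" using T closed by (auto simp: good_def)
    then have "{} \<in> ?\<U>" by auto
    then show "?\<U> \<noteq> {}" by blast
  next
    fix \<C> assume ne: "\<C> \<noteq> {}" and chain: "subset.chain ?\<U> \<C>"
    have sub: "\<C> \<subseteq> ?\<U>" using chain by (auto simp: subset.chain_def)
    have lin: "\<And>U V. U \<in> \<C> \<Longrightarrow> V \<in> \<C> \<Longrightarrow> U \<subseteq> V \<or> V \<subseteq> U"
      using chain by (auto simp: subset_chain_def)
    have fin_Un: "\<Union>\<F> \<in> \<C>" if "finite \<F>" "\<F> \<subseteq> \<C>" "\<F> \<noteq> {}" for \<F>
      using that(1,3,2)
    proof (induction rule: finite_ne_induct)
      case (insert U \<F>)
      then have "U \<in> \<C>" "\<Union>\<F> \<in> \<C>" by auto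
      then have "U \<subseteq> \<Union>\<F> \<or> \<Union>\<F> \<subseteq> U"
        by (rule lin)
      then have "\<Union>(insert U \<F>) = \<Union>\<F> \<or> \<Union>(insert U \<F>) = U" unfolding Union_insert by blast
      with \<open>U \<in> \<C>\<close> \<open>\<Union>\<F> \<in> \<C>\<close> show ?case by metis
    qed auto
    have eq: "topspace T - \<Union>\<C> = \<Inter>((-) (topspace T) ` \<C>)" using ne by auto
    have cl: "closedin T (topspace T - \<Union>\<C>)"
      unfolding eq using ne sub by (intro closedin_Inter) (auto simp: good_def)
    have "\<Inter>\<F> \<noteq> {}" if fin: "finite \<F>" "\<F> \<subseteq> (-) (topspace T) ` \<C>" for \<F>
    proof (cases "\<F> = {}")
      case False
      obtain \<G> where \<G>: "\<G> \<subseteq> \<C>" "finite \<G>" "\<F> = (-) (topspace T) ` \<G>"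
        using finite_subset_image[OF fin] by blast
      with False have "\<G> \<noteq> {}" by auto
      then have "\<Union>\<G> \<in> ?\<U>" using fin_Un \<G> sub by blast
      moreover have "\<Inter>\<F> = topspace T - \<Union>\<G>" using \<G> \<open>\<G> \<noteq> {}\<close> by auto
      ultimately show ?thesis by (auto simp: good_def)
    qed auto
    moreover have "closedin T C" if "C \<in> (-) (topspace T) ` \<C>" for C
      using that sub by (auto simp: good_def)
    ultimately have "\<Inter>((-) (topspace T) ` \<C>) \<noteq> {}"
      by (intro T(1)[unfolded compact_space_fip, rule_format]) simp
    moreover have "mul x y \<in> topspace T - \<Union>\<C>"
      if xy: "x \<in> topspace T - \<Union>\<C>" "y \<in> topspace T - \<Union>\<C>" for x y
    proof -
      have "mul x y \<notin> U" if "U \<in> \<C>" for U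
      proof -
        have "good (topspace T - U)" "x \<in> topspace T - U" "y \<in> topspace T - U"
          using that sub xy by auto
        then show ?thesis unfolding good_def by blast
      qed
      then show ?thesis using xy closed by simp
    qed
    ultimately have "good (topspace T - \<Union>\<C>)" using cl eq by (auto simp: good_def)
    then show "\<Union>\<C> \<in> ?\<U>" using sub by auto
  qed
  then obtain U where "U \<in> ?\<U>" and max: "\<forall>V\<in>?\<U>. U \<subseteq> V \<longrightarrow> V = U" by (rule bexE)
  then have U: "U \<subseteq> topspace T" "good (topspace T - U)" by auto
  show ?thesis
  proof (rule that[of "topspace T - U"])
    have "R = topspace T - U" if R: "closedin T R" "R \<noteq> {}" "\<forall>x\<in>R. \<forall>y\<in>R. mul x y \<in> R"
      "R \<subseteq> topspace T - U" for R
    proof -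
      have "topspace T - (topspace T - R) = R" using R by (auto dest: closedin_subset)
      with R have "good (topspace T - (topspace T - R))" by (auto simp: good_def)
      then have "topspace T - R = U" using U R(4) by (intro max[rule_format]) auto
      then show "R = topspace T - U" using R closedin_subset by blast
    qed
    then show "\<forall>R. closedin T R \<and> R \<noteq> {} \<and> (\<forall>x\<in>R. \<forall>y\<in>R. mul x y \<in> R) \<and> R \<subseteq> topspace T - U \<longrightarrow>
        R = topspace T - U" by blast
  qed (use U in \<open>auto simp: good_def\<close>)
qed

text \<open>Take \<open>p\<close> in a minimal closed subsemigroup \<open>S\<close>. The products
  \<open>mul q p\<close> with \<open>q\<close> in \<open>S\<close> form a closed subsemigroup, hence
  all of \<open>S\<close>, so \<open>mul q p = p\<close> for some \<open>q\<close>. The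
  \<open>q\<close> with this property again form a closed subsemigroup, hence all of
  \<open>S\<close>, and \<open>p\<close> is one of them. Both closedness claims rest on continuity
  in the left factor.\<close>

lemma ellis_numakura_idempotent:
  assumes T: "compact_space T" "Hausdorff_space T" "topspace T \<noteq> {}"
    and closed: "\<And>x y. x \<in> topspace T \<Longrightarrow> y \<in> topspace T \<Longrightarrow> mul x y \<in> topspace T"
    and assoc: "\<And>x y z. x \<in> topspace T \<Longrightarrow> y \<in> topspace T \<Longrightarrow> z \<in> topspace T \<Longrightarrow>
      mul (mul x y) z = mul x (mul y z)"
    and cont: "\<And>p. p \<in> topspace T \<Longrightarrow> continuous_map T T (\<lambda>q. mul q p)"
  obtains p where "p \<in> topspace T" "mul p p = p"
proof -
  obtain S where S: "closedin T S" "S \<noteq> {}" and S_mul: "\<forall>x\<in>S. \<forall>y\<in>S. mul x y \<in> S"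
    and minS: "\<forall>R. closedin T R \<and> R \<noteq> {} \<and> (\<forall>x\<in>R. \<forall>y\<in>R. mul x y \<in> R) \<and> R \<subseteq> S \<longrightarrow> R = S"
    using minimal_closed_subsemigroup[OF T(1,3), of mul, OF closed] by blast
  have min: "R = S" if "closedin T R" "R \<noteq> {}" "\<And>x y. x \<in> R \<Longrightarrow> y \<in> R \<Longrightarrow> mul x y \<in> R" "R \<subseteq> S" for R
    using minS that by blast
  have sub: "S \<subseteq> topspace T" using S(1) closedin_subset by blast
  obtain p where p: "p \<in> S" using S(2) by blast
  have pT: "p \<in> topspace T" using p sub by blast
  have "(\<lambda>q. mul q p) ` S = S"
  proof (rule min)
    show "closedin T ((\<lambda>q. mul q p) ` S)"
      using closedin_compact_space[OF T(1) S(1)] image_compactin[OF _ cont[OF pT]] T(2)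
      by (blast intro: compactin_imp_closedin)
    fix x y assume "x \<in> (\<lambda>q. mul q p) ` S" "y \<in> (\<lambda>q. mul q p) ` S"
    then obtain a b where ab: "a \<in> S" "b \<in> S" "x = mul a p" "y = mul b p" by blast
    then have "mul a p \<in> topspace T" "b \<in> topspace T" using S_mul p sub by blast+
    then have "mul x y = mul (mul (mul a p) b) p"
      using assoc[of "mul a p" b p] pT ab by simp
    then show "mul x y \<in> (\<lambda>q. mul q p) ` S" using ab S_mul p by blast
  qed (use S S_mul p in auto)
  then have ne: "{q \<in> S. mul q p = p} \<noteq> {}" using p by force
  have "{q \<in> S. mul q p = p} = S"
  proof (rule min)
    have "closedin T {q \<in> topspace T. mul q p \<in> {p}}"
      using T(2) pT by (intro closedin_continuous_map_preimage[OF cont]) (auto simp: closedin_Hausdorff_sing_eq)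
    then have "closedin T (S \<inter> {q \<in> topspace T. mul q p \<in> {p}})" using S(1) by blast
    also have "S \<inter> {q \<in> topspace T. mul q p \<in> {p}} = {q \<in> S. mul q p = p}" using sub by auto
    finally show "closedin T {q \<in> S. mul q p = p}" .
    fix x y assume "x \<in> {q \<in> S. mul q p = p}" "y \<in> {q \<in> S. mul q p = p}"
    moreover from this have "x \<in> topspace T" "y \<in> topspace T" using sub by blast+
    ultimately show "mul x y \<in> {q \<in> S. mul q p = p}"
      using S_mul assoc[of x y p] pT by simp
  qed (use ne in auto)
  then show ?thesis using that p pT by blast
qed

section \<open>Recurrence of distal points along finite sums\<close>

text \<open>The IP set generated by the tail of \<open>s\<close> from index \<open>k\<close> on.
  Tails allow sums with disjoint index sets to be chosen, and these add up to sums again.\<close>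

definition finite_sums :: "(nat \<Rightarrow> nat) \<Rightarrow> nat \<Rightarrow> nat set" where
  "finite_sums s k = {sum s F |F. finite F \<and> F \<noteq> {} \<and> F \<subseteq> {k..}}"

context Metric_space
begin

text \<open>The liminf controls late times; at the finitely many early ones injectivity keeps the
  two orbits apart.\<close>

lemma distal_bounded_below:
  assumes f: "f \<in> M \<rightarrow> M" and inj: "inj_on f M"
    and distal: "distal_on M d f" and xy: "x \<in> M" "y \<in> M" "x \<noteq> y"
  obtains c where "c > 0" "\<And>n. c \<le> d ((f ^^ n) x) ((f ^^ n) y)"
proof -
  have M: "(f ^^ n) z \<in> M" if "z \<in> M" for n z
    using f that by (induction n) auto
  have neq: "(f ^^ n) x \<noteq> (f ^^ n) y" for n
    using xy M inj by (induction n) (auto dest: inj_onD)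
  have "liminf (\<lambda>n. ereal (d ((f ^^ n) x) ((f ^^ n) y))) > 0"
    using distal xy by (auto simp: distal_on_def distal_pair_def)
  then obtain c where c: "0 < ereal c" "ereal c < liminf (\<lambda>n. ereal (d ((f ^^ n) x) ((f ^^ n) y)))"
    using ereal_dense2 by blast
  then have "\<forall>\<^sub>F n in sequentially. ereal c < ereal (d ((f ^^ n) x) ((f ^^ n) y))"
    using less_LiminfD by blast
  then obtain N where N: "\<And>n. n \<ge> N \<Longrightarrow> c < d ((f ^^ n) x) ((f ^^ n) y)"
    by (auto simp: eventually_sequentially)
  define e where "e = Min (insert c ((\<lambda>n. d ((f ^^ n) x) ((f ^^ n) y)) ` {..<N}))"
  have "e > 0" using c(1) neq M xy by (auto simp: e_def)
  moreover have "e \<le> d ((f ^^ n) x) ((f ^^ n) y)" for n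
  proof (cases "n < N")
    case True
    then show ?thesis unfolding e_def by (intro Min_le) auto
  next
    case False
    have "e \<le> c" unfolding e_def by (intro Min_le) auto
    with N[of n] False show ?thesis by auto
  qed
  ultimately show ?thesis by (rule that)
qed

text \<open>In the compact space of self-maps of \<open>M\<close> with pointwise convergence, the
  iterates along sums over later and later indices accumulate on a closed set \<open>S\<close>. It
  is a semigroup under composition because sums over disjoint index sets add up, so Ellis-Numakura
  gives an idempotent \<open>p\<close> in it. A basic neighbourhood of \<open>p\<close> constrains
  finitely many points, so one \<open>s\<close> serves both \<open>x\<close> and
  \<open>y\<close>.\<close>

lemma idempotent_limit_of_finite_sums:
  assumes compact: "compact_space mtopology" and cont: "continuous_map mtopology mtopology f"
    and ne: "M \<noteq> {}"
  obtains p where "p \<in> M \<rightarrow> M" "\<And>z. z \<in> M \<Longrightarrow> p (p z) = p z"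
    "\<And>x y \<epsilon>. x \<in> M \<Longrightarrow> y \<in> M \<Longrightarrow> \<epsilon> > 0 \<Longrightarrow>
      \<exists>s\<in>finite_sums r 0. d ((f ^^ s) x) (p x) < \<epsilon> \<and> d ((f ^^ s) y) (p y) < \<epsilon>"
proof -
  have cont_iter: "continuous_map mtopology mtopology (f ^^ n)" for n
    by (induction n) (use continuous_map_compose[OF _ cont] in \<open>auto simp: o_def\<close>)
  have M: "(f ^^ n) z \<in> M" if "z \<in> M" for n z
    using cont_iter[of n] that by (auto simp: continuous_map_def)
  let ?P = "product_topology (\<lambda>_. mtopology) M"
  \<comment> \<open>Composition, restricted to \<open>M\<close> so that it stays within the
    extensional maps that form the product space.\<close>
  define mul where "mul q p = (\<lambda>z\<in>M. q (p z))" for q p :: "'a \<Rightarrow> 'a"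
  define Orb where "Orb k = (\<lambda>s. restrict (f ^^ s) M) ` finite_sums r k" for k
  define S where "S = (\<Inter>k. ?P closure_of Orb k)"
  have P: "topspace ?P = M \<rightarrow>\<^sub>E M" by simp
  have Orb_sub: "Orb k \<subseteq> topspace ?P" for k using M by (auto simp: Orb_def)
  have comp: "compact_space ?P" using compact by (simp add: compact_space_product_topology)
  have haus: "Hausdorff_space ?P"
    by (simp add: Hausdorff_space_product_topology Hausdorff_space_mtopology)
  have cl: "closedin ?P S" by (auto simp: S_def)
  have anti: "Orb k \<subseteq> Orb l" if "l \<le> k" for k l
    unfolding Orb_def finite_sums_def using that by fastforce
  have "S \<noteq> {}"
  proof -
    have "\<Inter>\<F> \<noteq> {}" if fin: "finite \<F>" "\<F> \<subseteq> range (\<lambda>k. ?P closure_of Orb k)" for \<F>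
    proof -
      obtain K where K: "finite K" "\<F> = (\<lambda>k. ?P closure_of Orb k) ` K"
        using finite_subset_image[OF fin] by blast
      obtain m where m: "\<And>k. k \<in> K \<Longrightarrow> k \<le> m" using K(1) by (meson finite_nat_set_iff_bounded_le)
      have "restrict (f ^^ r m) M \<in> Orb m"
        unfolding Orb_def finite_sums_def by (intro image_eqI[OF refl] CollectI exI[of _ "{m}"]) auto
      then have "restrict (f ^^ r m) M \<in> ?P closure_of Orb k" if "k \<in> K" for k
        using anti[OF m[OF that]] closure_of_subset[OF Orb_sub] by blast
      then show ?thesis using K by blast
    qed
    then show ?thesis
      unfolding S_def by (intro comp[unfolded compact_space_fip, rule_format]) auto
  qed
  have right: "continuous_map ?P ?P (\<lambda>q. mul q p)" if "p \<in> M \<rightarrow> M" for p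
    unfolding continuous_map_componentwise mul_def
  proof (intro conjI ballI)
    fix k assume k: "k \<in> M"
    then have "p k \<in> M" using that by auto
    then show "continuous_map ?P mtopology (\<lambda>x. (\<lambda>z\<in>M. x (p z)) k)"
      using k continuous_map_product_projection[of "p k" M "\<lambda>_. mtopology"] by simp
  qed auto
  \<comment> \<open>Limits of iterates may be discontinuous, so closure of \<open>S\<close> under
    \<open>mul\<close> is shown first with an iterate as left factor, using \<open>left\<close>, and
    then for limits of such factors, using \<open>right\<close>.\<close>
  have left: "continuous_map ?P ?P (\<lambda>q. mul (f ^^ n) q)" for n
    unfolding continuous_map_componentwise mul_def
  proof (intro conjI ballI)
    fix k assume k: "k \<in> M"
    have "continuous_map ?P mtopology ((f ^^ n) \<circ> (\<lambda>q. q k))"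
      by (rule continuous_map_compose[OF continuous_map_product_projection[OF k] cont_iter])
    then show "continuous_map ?P mtopology (\<lambda>x. (\<lambda>z\<in>M. (f ^^ n) (x z)) k)"
      using k by (simp add: o_def)
  qed auto
  have semi: "mul q p \<in> S" if q: "q \<in> S" and p: "p \<in> S" for q p
    unfolding S_def
  proof (rule INT_I)
    fix k
    have pP: "p \<in> M \<rightarrow>\<^sub>E M" using p closedin_subset[OF cl] by auto
    have "mul g p \<in> ?P closure_of Orb k" if g: "g \<in> Orb k" for g
    proof -
      obtain F where F: "finite F" "F \<noteq> {}" "F \<subseteq> {k..}" "g = restrict (f ^^ sum r F) M"
        using g by (auto simp: Orb_def finite_sums_def)
      \<comment> \<open>With \<open>m\<close> beyond \<open>F\<close>, a sum over \<open>F\<close>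
        plus a sum over indices from \<open>m\<close> on is a sum over their disjoint union.\<close>
      obtain m where m: "\<And>i. i \<in> F \<Longrightarrow> i < m" using finite_nat_bounded[OF F(1)] by blast
      have "mul (f ^^ sum r F) h \<in> Orb k" if h: "h \<in> Orb m" for h
      proof -
        obtain G where G: "finite G" "G \<noteq> {}" "G \<subseteq> {m..}" "h = restrict (f ^^ sum r G) M"
          using h by (auto simp: Orb_def finite_sums_def)
        have "F \<inter> G = {}" using m G(3) by fastforce
        then have "sum r (F \<union> G) = sum r F + sum r G" using F G by (simp add: sum.union_disjoint)
        then have "mul (f ^^ sum r F) h = restrict (f ^^ sum r (F \<union> G)) M"
          using G by (auto simp: mul_def funpow_add)
        moreover have "F \<union> G \<subseteq> {k..}"
        proof -
          obtain i where "i \<in> F" using F by blast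
          then have "k \<le> m" using m[of i] F(3) by auto
          then show ?thesis using F G by auto
        qed
        ultimately show ?thesis using F G unfolding Orb_def finite_sums_def by blast
      qed
      then have "mul (f ^^ sum r F) ` Orb m \<subseteq> Orb k" by blast
      then have "mul (f ^^ sum r F) ` (?P closure_of Orb m) \<subseteq> ?P closure_of Orb k"
        using continuous_map_image_closure_subset[OF left, of "sum r F" "Orb m"] closure_of_mono by blast
      moreover have "p \<in> ?P closure_of Orb m" using p by (auto simp: S_def)
      moreover have "mul g p = mul (f ^^ sum r F) p"
        using pP by (auto simp: mul_def F(4) intro!: restrict_ext)
      ultimately show ?thesis by auto
    qed
    then have "(\<lambda>q. mul q p) ` Orb k \<subseteq> ?P closure_of Orb k" by blast
    then have "?P closure_of ((\<lambda>q. mul q p) ` Orb k) \<subseteq> ?P closure_of Orb k"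
      by (simp add: closure_of_minimal)
    moreover have "q \<in> ?P closure_of Orb k" using q by (auto simp: S_def)
    then have "mul q p \<in> ?P closure_of ((\<lambda>q. mul q p) ` Orb k)"
      using continuous_map_image_closure_subset[OF right, of p "Orb k"] pP by blast
    ultimately show "mul q p \<in> ?P closure_of Orb k" by blast
  qed
  have top: "topspace (subtopology ?P S) = S" using closedin_subset[OF cl] by auto
  have SP: "S \<subseteq> M \<rightarrow>\<^sub>E M" using closedin_subset[OF cl] by simp
  have "\<exists>p. p \<in> S \<and> mul p p = p"
  proof (rule ellis_numakura_idempotent[of "subtopology ?P S" mul], unfold top)
    show "compact_space (subtopology ?P S)"
      using closedin_compact_space[OF comp cl] compact_space_subtopology by blast
    show "Hausdorff_space (subtopology ?P S)" using haus Hausdorff_space_subtopology by blast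
    show "mul (mul x y) z = mul x (mul y z)" if "x \<in> S" "y \<in> S" "z \<in> S" for x y z
      using that SP by (auto simp: mul_def restrict_def PiE_iff subset_iff fun_eq_iff)
    show "continuous_map (subtopology ?P S) (subtopology ?P S) (\<lambda>q. mul q p)" if p: "p \<in> S" for p
    proof -
      have "p \<in> M \<rightarrow> M" using SP p by auto
      then show ?thesis
        using semi p top
        by (auto simp: continuous_map_in_subtopology continuous_map_from_subtopology right)
    qed
    show "S \<noteq> {}" by fact
    show "mul q p \<in> S" if "q \<in> S" "p \<in> S" for q p
      using that by (rule semi)
    show "\<exists>p. p \<in> S \<and> mul p p = p" if "p \<in> S" "mul p p = p" for p
      using that by blast
  qed
  then obtain p where p: "p \<in> S" "mul p p = p" by blast
  have pM: "p \<in> M \<rightarrow> M" using p SP by auto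
  show ?thesis
  proof (rule that[of p])
    show "p (p z) = p z" if "z \<in> M" for z
      using fun_cong[OF p(2), of z] that by (simp add: mul_def)
    fix x y and \<epsilon> :: real assume xy: "x \<in> M" "y \<in> M" and "\<epsilon> > 0"
    define V where "V z = {q \<in> topspace ?P. q z \<in> mball (p z) \<epsilon>}" for z
    have "openin ?P (V z)" if "z \<in> M" for z
      unfolding V_def using that
      by (intro openin_continuous_map_preimage[OF continuous_map_product_projection]) auto
    then have "openin ?P (V x \<inter> V y)" using xy by blast
    moreover have "p \<in> V x \<inter> V y"
      using p SP pM xy \<open>\<epsilon> > 0\<close> by (auto simp: V_def Pi_iff)
    moreover have "p \<in> ?P closure_of Orb 0" using p by (auto simp: S_def)
    ultimately obtain g where g: "g \<in> Orb 0" "g \<in> V x \<inter> V y" unfolding in_closure_of by blast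
    then obtain s where "s \<in> finite_sums r 0" and "g = restrict (f ^^ s) M" by (auto simp: Orb_def)
    moreover from g(2) have "d (p x) (g x) < \<epsilon>" "d (p y) (g y) < \<epsilon>" by (auto simp: V_def)
    ultimately have "d ((f ^^ s) x) (p x) < \<epsilon>" "d ((f ^^ s) y) (p y) < \<epsilon>"
      using xy by (simp_all add: commute[of "p _"])
    with \<open>s \<in> finite_sums r 0\<close> show "\<exists>s\<in>finite_sums r 0. d ((f ^^ s) x) (p x) < \<epsilon> \<and> d ((f ^^ s) y) (p y) < \<epsilon>"
      by blast
  qed (rule pM)
qed

lemma distal_finite_sums_recurrent:
  assumes compact: "compact_space mtopology" and cont: "continuous_map mtopology mtopology f"
    and inj: "inj_on f M" and distal: "distal_on M d f" and x: "x \<in> M" and "\<epsilon> > 0"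
  obtains s where "s \<in> finite_sums r 0" "d ((f ^^ s) x) x < \<epsilon>"
proof -
  obtain p where p: "p \<in> M \<rightarrow> M" "\<And>z. z \<in> M \<Longrightarrow> p (p z) = p z"
    and near: "\<And>x y \<epsilon>. x \<in> M \<Longrightarrow> y \<in> M \<Longrightarrow> \<epsilon> > 0 \<Longrightarrow>
      \<exists>s\<in>finite_sums r 0. d ((f ^^ s) x) (p x) < \<epsilon> \<and> d ((f ^^ s) y) (p y) < \<epsilon>"
    using idempotent_limit_of_finite_sums[OF compact cont] x by blast
  have f: "f \<in> M \<rightarrow> M" using cont by (auto simp: continuous_map_def)
  have M: "(f ^^ n) z \<in> M" if "z \<in> M" for n z
    using f that by (induction n) auto
  have px: "p x \<in> M" using p x by auto
  have "p x = x"
  proof (rule ccontr)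
    assume "p x \<noteq> x"
    then obtain c where c: "c > 0" "\<And>n. c \<le> d ((f ^^ n) x) ((f ^^ n) (p x))"
      using distal_bounded_below[OF f inj distal x px] by metis
    \<comment> \<open>By idempotence \<open>p\<close> sends both \<open>x\<close> and
      \<open>p x\<close> to \<open>p x\<close>, so a single time \<open>s\<close> brings the two
      orbits closer than \<open>c\<close>.\<close>
    obtain s where s: "d ((f ^^ s) x) (p x) < c/2" "d ((f ^^ s) (p x)) (p x) < c/2"
      using near[OF x px, of "c/2"] c(1) p(2)[OF x] by auto
    have "d ((f ^^ s) x) ((f ^^ s) (p x)) \<le> d ((f ^^ s) x) (p x) + d (p x) ((f ^^ s) (p x))"
      using x px M by (intro triangle) auto
    with s c(2)[of s] show False by (simp add: commute)
  qed
  then show ?thesis using that near[OF x x \<open>\<epsilon> > 0\<close>] by auto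
qed

end

section \<open>Splitting a separated family by tests\<close>

text \<open>
  The tests are processed from the last to the first. At each of them the least popular gap \<open>c\<close> is
  discarded and the rest is split into the part below and the part above the gap; an element of
  \<open>J\<close> is a step into the upper part while the lower part, from which \<open>w\<close> is chosen, is not empty.
\<close>

lemma separated_family_staircase:
  fixes v :: "nat \<Rightarrow> 'b \<Rightarrow> nat" and q :: nat
  assumes "finite C" and q: "q \<ge> 1"
    and "\<And>A B. A \<in> C \<Longrightarrow> B \<in> C \<Longrightarrow> A \<noteq> B \<Longrightarrow>
      \<exists>i<N. v i A = 0 \<and> v i B > Suc q \<or> v i B = 0 \<and> v i A > Suc q"
    and "(1 + 1 / q) ^ (2 * N) * real q ^ K < card C"
  shows "\<exists>J c w. J \<subseteq> {..<N} \<and> card J = K \<and> (\<forall>j\<in>J. c j \<in> {1..Suc q} \<and> w j \<in> C \<and> v j (w j) < c j \<and>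
    (\<forall>i\<in>J. j < i \<longrightarrow> c i < v i (w j)))"
  using assms(1,3,4)
proof (induction N arbitrary: C K)
  case 0
  \<comment> \<open>There is more than one element but no test to separate two of them.\<close>
  have "1 \<le> q ^ K" using q by simp
  moreover have "q ^ K < card C" using 0 by simp
  ultimately have "Suc 0 < card C" by linarith
  then obtain A B where "A \<in> C" "B \<in> C" "A \<noteq> B" using card_le_Suc0_iff_eq[OF \<open>finite C\<close>] by fastforce
  with 0(2)[of A B] show ?case by simp
next
  case (Suc N C K)
  \<comment> \<open>Each test costs two factors \<open>1 + 1/q\<close>: one pays for the discarded
    gap, the other for \<open>F K + F K'\<close>, where \<open>F K' = F K / q\<close> if
    \<open>K = Suc K'\<close>.\<close>
  define b where "b = (1 + 1 / real q) ^ 2"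
  define F where "F K = b ^ N * real q ^ K" for K
  \<comment> \<open>Test \<open>N\<close> separates no two elements of such a part \<open>D\<close>,
    so the tests before \<open>N\<close> separate it.\<close>
  have IH: "\<exists>J c w. J \<subseteq> {..<N} \<and> card J = K \<and> (\<forall>j\<in>J. c j \<in> {1..Suc q} \<and> w j \<in> D \<and>
      v j (w j) < c j \<and> (\<forall>i\<in>J. j < i \<longrightarrow> c i < v i (w j)))"
    if "D \<subseteq> C" "F K < card D"
      and "(\<forall>A\<in>D. v N A \<noteq> 0) \<or> (\<forall>A\<in>D. v N A \<le> Suc q)" for D K
  proof (rule Suc.IH)
    show "finite D" using that(1) Suc.prems(1) by (rule finite_subset)
    show "(1 + 1 / real q) ^ (2 * N) * real q ^ K < real (card D)"
      using that(2) by (simp add: F_def b_def power_mult)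
    fix A B assume AB: "A \<in> D" "B \<in> D" "A \<noteq> B"
    then have "\<exists>i<Suc N. v i A = 0 \<and> v i B > Suc q \<or> v i B = 0 \<and> v i A > Suc q"
      using that(1) by (intro Suc.prems(2)) auto
    then obtain i where i: "i < Suc N" "v i A = 0 \<and> v i B > Suc q \<or> v i B = 0 \<and> v i A > Suc q"
      by blast
    moreover have "i \<noteq> N" using i(2) that(3) AB by fastforce
    ultimately show "\<exists>i<N. v i A = 0 \<and> v i B > Suc q \<or> v i B = 0 \<and> v i A > Suc q"
      using less_Suc_eq by blast
  qed
  show ?case
  proof (cases K)
    case 0
    then show ?thesis by (intro exI[of _ "{}"]) auto
  next
    case (Suc K')
    \<comment> \<open>The \<open>Suc q\<close> candidate gaps cut out disjoint subsets of
      \<open>C\<close>, so one of them holds at most the average share.\<close>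
    have "\<exists>c\<in>{1..Suc q}. Suc q * card {A\<in>C. v N A = c} \<le> card C"
    proof (rule ccontr)
      assume "\<not> ?thesis"
      then have "(\<Sum>c\<in>{1..Suc q}. card C) < (\<Sum>c\<in>{1..Suc q}. Suc q * card {A\<in>C. v N A = c})"
        by (intro sum_strict_mono) (simp_all only: not_le[symmetric], auto)
      also have "\<dots> = Suc q * (\<Sum>c\<in>{1..Suc q}. card {A\<in>C. v N A = c})"
        by (simp only: sum_distrib_left)
      finally have less: "Suc q * card C < Suc q * (\<Sum>c\<in>{1..Suc q}. card {A\<in>C. v N A = c})"
        by simp
      have "(\<Sum>c\<in>{1..Suc q}. card {A\<in>C. v N A = c}) = card (\<Union>c\<in>{1..Suc q}. {A\<in>C. v N A = c})"
        using Suc.prems(1) by (subst card_UN_disjoint) auto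
      also have "\<dots> \<le> card C" using Suc.prems(1) by (intro card_mono) auto
      finally show False using less by (meson mult_le_mono2 not_le)
    qed
    then obtain c where c: "c \<in> {1..Suc q}" and
      least: "Suc q * card {A\<in>C. v N A = c} \<le> card C" by blast
    define H where "H = {A\<in>C. v N A < c}"
    define U where "U = {A\<in>C. c < v N A}"
    have "C = H \<union> U \<union> {A\<in>C. v N A = c}" by (auto simp: H_def U_def)
    then have "card C \<le> card H + card U + card {A\<in>C. v N A = c}"
      using card_Un_le[of "H \<union> U" "{A\<in>C. v N A = c}"] card_Un_le[of H U] by simp
    then have "Suc q * card C \<le> Suc q * (card H + card U) + Suc q * card {A\<in>C. v N A = c}"
      using mult_le_mono2[of _ _ "Suc q"] by (simp only: distrib_left[symmetric])
    then have "q * card C \<le> Suc q * (card H + card U)" using least by simp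
    then have "q * real (card C) \<le> (1 + real q) * (real (card H) + real (card U))"
      by (metis of_nat_Suc of_nat_add of_nat_le_iff of_nat_mult)
    moreover have "b ^ Suc N * real q ^ K < real (card C)"
      using Suc.prems(3) by (simp only: b_def power_mult[symmetric])
    then have "q * (b ^ Suc N * real q ^ K) < q * real (card C)"
      using q by (intro mult_strict_left_mono) auto
    ultimately have "q * (b ^ Suc N * real q ^ K) < (1 + real q) * (real (card H) + real (card U))"
      by linarith
    moreover have "q * (b ^ Suc N * real q ^ K) = (1 + real q) * (F K + F K')"
      using q by (simp add: b_def F_def Suc field_simps power2_eq_square)
    ultimately have sum: "F K + F K' < real (card H) + real (card U)" using q by simp
    have H_sub: "H \<subseteq> C" and U_sub: "U \<subseteq> C" by (auto simp: H_def U_def)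
    have mono: "\<exists>J c w. J \<subseteq> {..<Suc N} \<and> card J = K \<and> (\<forall>j\<in>J. c j \<in> {1..Suc q} \<and> w j \<in> C \<and>
        v j (w j) < c j \<and> (\<forall>i\<in>J. j < i \<longrightarrow> c i < v i (w j)))"
      if sub: "D \<subseteq> C" and D: "\<exists>J c w. J \<subseteq> {..<N} \<and> card J = K \<and> (\<forall>j\<in>J. c j \<in> {1..Suc q} \<and> w j \<in> D \<and>
        v j (w j) < c j \<and> (\<forall>i\<in>J. j < i \<longrightarrow> c i < v i (w j)))" for D
    proof -
      obtain J c w where J: "J \<subseteq> {..<N}" "card J = K" and
        w: "\<And>j. j \<in> J \<Longrightarrow> c j \<in> {1..Suc q} \<and> w j \<in> D \<and>
          v j (w j) < c j \<and> (\<forall>i\<in>J. j < i \<longrightarrow> c i < v i (w j))" using D by blast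
      have "J \<subseteq> {..<Suc N}" using J(1) by auto
      then show ?thesis
        using J(2) w sub by (intro exI[of _ J] exI[of _ c] exI[of _ w]) blast
    qed
    \<comment> \<open>If neither part is large enough for \<open>K\<close> steps, both have more
      than \<open>F K'\<close> elements: \<open>U\<close> yields \<open>K'\<close> steps, and
      \<open>H\<close>, being nonempty, provides the witness for one more step at
      \<open>N\<close>.\<close>
    consider "F K < card H" | "F K < card U" | "F K' < card U" "H \<noteq> {}"
    proof (cases "F K < card H \<or> F K < card U")
      case False
      then have "F K' < card U" "F K' < card H" using sum by linarith+
      moreover have "0 \<le> F K'" by (simp add: F_def b_def)
      ultimately show ?thesis using that(3) by fastforce
    qed (use that in blast)
    then show ?thesis
    proof cases
      case 1
      then have "\<exists>J c w. J \<subseteq> {..<N} \<and> card J = K \<and> (\<forall>j\<in>J. c j \<in> {1..Suc q} \<and> w j \<in> H \<and>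
        v j (w j) < c j \<and> (\<forall>i\<in>J. j < i \<longrightarrow> c i < v i (w j)))"
        using c by (intro IH) (auto simp: H_def)
      then show ?thesis by (rule mono[OF H_sub])
    next
      case 2
      then have "\<exists>J c w. J \<subseteq> {..<N} \<and> card J = K \<and> (\<forall>j\<in>J. c j \<in> {1..Suc q} \<and> w j \<in> U \<and>
        v j (w j) < c j \<and> (\<forall>i\<in>J. j < i \<longrightarrow> c i < v i (w j)))"
        by (intro IH) (auto simp: U_def)
      then show ?thesis by (rule mono[OF U_sub])
    next
      case 3
      then have "\<exists>J c w. J \<subseteq> {..<N} \<and> card J = K' \<and> (\<forall>j\<in>J. c j \<in> {1..Suc q} \<and> w j \<in> U \<and>
        v j (w j) < c j \<and> (\<forall>i\<in>J. j < i \<longrightarrow> c i < v i (w j)))"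
        by (intro IH) (auto simp: U_def)
      then obtain J c' w where J: "J \<subseteq> {..<N}" "card J = K'" and
        w: "\<And>j. j \<in> J \<Longrightarrow> c' j \<in> {1..Suc q} \<and> w j \<in> U \<and>
          v j (w j) < c' j \<and> (\<forall>i\<in>J. j < i \<longrightarrow> c' i < v i (w j))" by blast
      obtain A where A: "A \<in> H" using 3 by blast
      have "finite J" "N \<notin> J" using J(1) finite_subset by auto
      then have "card (insert N J) = K" using J Suc by simp
      \<comment> \<open>As \<open>N\<close> exceeds all of \<open>J\<close>, it adds one condition
        to each old step, which holds because \<open>w j\<close> lies in \<open>U\<close>; the step
        at \<open>N\<close> has no later step to satisfy.\<close>
      moreover have "(\<forall>j\<in>insert N J. (c'(N := c)) j \<in> {1..Suc q} \<and> (w(N := A)) j \<in> C \<and>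
          v j ((w(N := A)) j) < (c'(N := c)) j \<and>
          (\<forall>i\<in>insert N J. j < i \<longrightarrow> (c'(N := c)) i < v i ((w(N := A)) j)))"
        using A w c J(1) by (auto simp: H_def U_def)
      moreover have "insert N J \<subseteq> {..<Suc N}" using J(1) by auto
      ultimately show ?thesis by blast
    qed
  qed
qed

section \<open>Finite sums in sets of positive upper density\<close>

text \<open>A finitary positive upper density. The set may change with \<open>n\<close>, since the
  staircases obtained for different \<open>n\<close> are unrelated.\<close>

definition frequently_dense :: "(nat \<Rightarrow> nat set) \<Rightarrow> bool" where
  "frequently_dense E \<longleftrightarrow>
    (\<exists>\<delta>>0. \<exists>\<^sub>F n in sequentially. \<delta> * real n \<le> real (card (E n \<inter> {..<n})))"

text \<open>At infinitely many \<open>n\<close> some \<open>s\<close> has a fixed share of the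
  total; as \<open>I\<close> is finite, one \<open>s\<close> has it infinitely often.\<close>

lemma frequently_dense_pigeonhole:
  assumes "finite I" "\<delta> > 0"
    and freq: "\<exists>\<^sub>F n in sequentially. \<delta> * real n \<le> (\<Sum>s\<in>I. real (card (E s n \<inter> {..<n})))"
  shows "\<exists>s\<in>I. frequently_dense (E s)"
proof -
  \<comment> \<open>The \<open>+ 1\<close> makes the final comparison strict and covers empty
    \<open>I\<close>.\<close>
  define \<delta>' where "\<delta>' = \<delta> / (real (card I) + 1)"
  have "\<delta>' > 0" using \<open>\<delta> > 0\<close> by (simp add: \<delta>'_def add_pos_nonneg)
  have "\<exists>\<^sub>F n in sequentially. \<exists>s\<in>I. \<delta>' * real n \<le> real (card (E s n \<inter> {..<n}))"
  proof (rule frequently_elim1[OF frequently_eventually_conj[OF freq eventually_gt_at_top[of 0]]])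
    fix n :: nat
    assume n: "0 < n \<and> \<delta> * real n \<le> (\<Sum>s\<in>I. real (card (E s n \<inter> {..<n})))"
    show "\<exists>s\<in>I. \<delta>' * real n \<le> real (card (E s n \<inter> {..<n}))"
    proof (rule ccontr)
      assume "\<not> ?thesis"
      then have "(\<Sum>s\<in>I. real (card (E s n \<inter> {..<n}))) \<le> (\<Sum>s\<in>I. \<delta>' * real n)"
        by (intro sum_mono) auto
      also have "\<dots> = real (card I) * \<delta>' * real n" by simp
      also have "\<dots> < (real (card I) + 1) * \<delta>' * real n"
        using n \<open>\<delta>' > 0\<close> by (intro mult_strict_right_mono) auto
      also have "\<dots> = \<delta> * real n" by (simp add: \<delta>'_def)
      finally show False using n by simp
    qed
  qed
  then have "\<exists>s\<in>I. \<exists>\<^sub>F n in sequentially. \<delta>' * real n \<le> real (card (E s n \<inter> {..<n}))"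
    by (rule frequently_bex_finite[OF \<open>finite I\<close>])
  then show ?thesis
    unfolding frequently_dense_def using \<open>\<delta>' > 0\<close> by blast
qed

text \<open>Elements followed by a long gap are sparse, so most elements have a successor at bounded
  distance, and the pigeonhole principle fixes that distance.\<close>

lemma frequently_dense_shift:
  assumes "frequently_dense E"
  shows "\<exists>s>0. frequently_dense (\<lambda>n. {j \<in> E n. j + s \<in> E n})"
proof -
  obtain \<delta> where \<delta>: "\<delta> > 0" and
    freq: "\<exists>\<^sub>F n in sequentially. \<delta> * real n \<le> real (card (E n \<inter> {..<n}))"
    using assms by (auto simp: frequently_dense_def)
  \<comment> \<open>Elements followed by a gap longer than \<open>L\<close> number at most
    \<open>n / L + 1\<close>; this \<open>L\<close> makes \<open>n / L\<close> at most half of the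
    density bound.\<close>
  define L where "L = nat \<lceil>2 / \<delta>\<rceil>"
  have L: "2 / \<delta> \<le> L" unfolding L_def by linarith
  then have "L > 0" using \<delta> by (cases L) (auto simp: field_simps)
  define S where "S s n = {j \<in> E n. j + s \<in> E n}" for s n
  have "\<exists>s\<in>{1..L}. frequently_dense (S s)"
  proof (rule frequently_dense_pigeonhole)
    show "\<delta> / 4 > 0" using \<delta> by simp
    show "\<exists>\<^sub>F n in sequentially. \<delta> / 4 * real n \<le> (\<Sum>s\<in>{1..L}. real (card (S s n \<inter> {..<n})))"
    proof (rule frequently_elim1[OF frequently_eventually_conj[OF freq eventually_ge_at_top]])
      \<comment> \<open>For such \<open>n\<close> the extra 1 from the last block costs at most
        another quarter of the density bound.\<close>
      fix n assume "nat \<lceil>4/\<delta>\<rceil> \<le> n \<and> \<delta> * real n \<le> real (card (E n \<inter> {..<n}))"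
      then have n: "4/\<delta> \<le> n" and dens: "\<delta> * real n \<le> real (card (E n \<inter> {..<n}))"
        by linarith+
      \<comment> \<open>The elements of \<open>E n\<close> followed by a gap of more than \<open>L\<close> lie in different blocks of length \<open>L\<close>.\<close>
      define B where "B = {j \<in> E n \<inter> {..<n}. \<forall>s\<in>{1..L}. j + s \<notin> E n}"
      have "inj_on (\<lambda>j. j div L) B"
      proof (rule linorder_inj_onI)
        fix i j assume ij: "i < j" "i \<in> B" "j \<in> B"
        then have "\<forall>s\<in>{1..L}. i + s \<notin> E n" "j \<in> E n" by (auto simp: B_def)
        then have "j - i \<notin> {1..L}" using ij(1) by (metis le_add_diff_inverse less_imp_le)
        then have "i + L \<le> j" using ij(1) by auto
        then have "i div L < (i + L) div L" "(i + L) div L \<le> j div L"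
          using \<open>L > 0\<close> by (simp, intro div_le_mono)
        then show "i div L \<noteq> j div L" by simp
      qed auto
      then have "card B = card ((\<lambda>j. j div L) ` B)" by (simp add: card_image)
      also have "\<dots> \<le> card {..n div L}"
        by (intro card_mono) (auto simp: B_def intro!: div_le_mono)
      finally have "card B \<le> n div L + 1" by simp
      then have "real (card B) \<le> real n / L + 1" using of_nat_div_le_of_nat[of n L, where ?'a = real] by linarith
      also have "real n / L \<le> \<delta> / 2 * n"
      proof -
        have "1 / L \<le> \<delta> / 2" using L \<delta> \<open>L > 0\<close> by (simp add: field_simps)
        then show ?thesis using mult_right_mono[of "1/L" "\<delta>/2" "real n"] by simp
      qed
      finally have B: "real (card B) \<le> \<delta> / 2 * n + 1" by simp
      have "card (E n \<inter> {..<n}) \<le> card (B \<union> (\<Union>s\<in>{1..L}. S s n \<inter> {..<n}))"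
        by (intro card_mono) (auto simp: B_def S_def)
      also have "\<dots> \<le> card B + card (\<Union>s\<in>{1..L}. S s n \<inter> {..<n})" by (rule card_Un_le)
      also have "card (\<Union>s\<in>{1..L}. S s n \<inter> {..<n}) \<le> (\<Sum>s\<in>{1..L}. card (S s n \<inter> {..<n}))"
        by (rule card_UN_le) simp
      finally have "card (E n \<inter> {..<n}) \<le> card B + (\<Sum>s\<in>{1..L}. card (S s n \<inter> {..<n}))" by simp
      then have "real (card (E n \<inter> {..<n})) \<le> real (card B + (\<Sum>s\<in>{1..L}. card (S s n \<inter> {..<n})))"
        by (simp only: of_nat_le_iff)
      then have "real (card (E n \<inter> {..<n})) \<le> card B + (\<Sum>s\<in>{1..L}. real (card (S s n \<inter> {..<n})))"
        by simp
      moreover have "1 \<le> \<delta> / 4 * n" using n \<delta> by (simp add: field_simps)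
      ultimately show "\<delta> / 4 * real n \<le> (\<Sum>s\<in>{1..L}. real (card (S s n \<inter> {..<n})))"
        using B dens by argo
    qed
  qed simp
  then obtain s where "s \<in> {1..L}" "frequently_dense (S s)" by blast
  then show ?thesis unfolding S_def by (intro exI[of _ s]) auto
qed

text \<open>Iterating the shift: passing from \<open>G k\<close> to \<open>G (Suc k)\<close> keeps
  the elements whose translate by \<open>s k\<close> also lies in \<open>G k\<close>. The sequence
  \<open>s\<close> is fixed once for all \<open>k\<close>, while \<open>n\<close> and
  \<open>j\<close> vary with \<open>k\<close>.\<close>

lemma frequently_dense_finite_sums:
  assumes "frequently_dense E"
  obtains s where "\<And>i::nat. s i > 0" "\<And>k. \<exists>n. \<exists>j\<in>E n. \<forall>F\<subseteq>{..<k}. j + sum s F \<in> E n"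
proof -
  have "\<exists>G. \<forall>k. (frequently_dense (G k) \<and> (k = 0 \<longrightarrow> G k = E)) \<and>
    (\<exists>s>0. G (Suc k) = (\<lambda>n. {j \<in> G k n. j + s \<in> G k n}))"
    by (rule dependent_nat_choice) (use assms frequently_dense_shift in blast)+
  then obtain G where dense: "\<And>k. frequently_dense (G k)" and G0: "G 0 = E"
    and step: "\<And>k. \<exists>s>0. G (Suc k) = (\<lambda>n. {j \<in> G k n. j + s \<in> G k n})"
    by blast
  obtain s where s: "\<And>k. s k > (0::nat)"
    and G: "\<And>k. G (Suc k) = (\<lambda>n. {j \<in> G k n. j + s k \<in> G k n})"
    using step by metis
  have sums: "j + sum s F \<in> E n" if "j \<in> G k n" "F \<subseteq> {..<k}" for j k n F
    using that
  proof (induction k arbitrary: j F)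
    case 0
    then show ?case using G0 by auto
  next
    case (Suc k)
    show ?case
    proof (cases "k \<in> F")
      case True
      have "finite F" using Suc.prems(2) finite_subset by blast
      then have "sum s F = s k + sum s (F - {k})" using True by (simp add: sum.remove)
      moreover have "F - {k} \<subseteq> {..<k}" using Suc.prems(2) by (auto simp: less_Suc_eq)
      moreover have "j + s k \<in> G k n" using Suc.prems(1) G by simp
      ultimately show ?thesis using Suc.IH[of "j + s k" "F - {k}"] by (simp add: add.assoc)
    next
      case False
      then have "F \<subseteq> {..<k}" using Suc.prems(2) less_Suc_eq by blast
      then show ?thesis using Suc G by simp
    qed
  qed
  have "\<exists>n. \<exists>j\<in>E n. \<forall>F\<subseteq>{..<k}. j + sum s F \<in> E n" for k
  proof -
    obtain \<delta> where \<delta>: "\<delta> > 0"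
      and freq: "\<exists>\<^sub>F n in sequentially. \<delta> * real n \<le> real (card (G k n \<inter> {..<n}))"
      using dense[of k] by (auto simp: frequently_dense_def)
    have "\<exists>\<^sub>F n in sequentially. 0 < n \<and> \<delta> * real n \<le> real (card (G k n \<inter> {..<n}))"
      by (rule frequently_eventually_conj[OF freq eventually_gt_at_top])
    then obtain n where "0 < n" "\<delta> * real n \<le> real (card (G k n \<inter> {..<n}))"
      using frequently_ex by blast
    then have "card (G k n \<inter> {..<n}) \<noteq> 0" using \<delta> by (metis mult_pos_pos not_le of_nat_0 of_nat_0_less_iff)
    then obtain j where "j \<in> G k n" by fastforce
    then show ?thesis using sums[of j k n] sums[of j k n "{}"] by auto
  qed
  then show ?thesis using that[of s] s by simp
qed

section \<open>Distality against separated orbits of closed sets\<close>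

context Metric_space
begin

text \<open>The finite sums give points \<open>a k\<close> near \<open>y\<close> whose images at all
  sums over indices below \<open>k\<close> stay away from \<open>y\<close>. A limit point
  \<open>l\<close> of them would return close to itself at some such sum, and by continuity so would
  \<open>a k\<close> for large \<open>k\<close>.\<close>

lemma distal_no_frequently_dense:
  assumes compact: "compact_space mtopology" and cont: "continuous_map mtopology mtopology f"
    and inj: "inj_on f M" and distal: "distal_on M d f" and y: "y \<in> M" and "\<alpha> < \<beta>"
    and dense: "frequently_dense E"
    and escape: "\<And>n j. j \<in> E n \<Longrightarrow>
      \<exists>a\<in>M. d y a < \<alpha> \<and> (\<forall>i\<in>E n. j < i \<longrightarrow> \<beta> \<le> d y ((f ^^ (i - j)) a))"
  shows False
proof -
  obtain s where s: "\<And>i::nat. s i > 0" and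
    sums: "\<And>k. \<exists>n. \<exists>j\<in>E n. \<forall>F\<subseteq>{..<k}. j + sum s F \<in> E n"
    using frequently_dense_finite_sums[OF dense] by metis
  have "\<exists>a. a \<in> M \<and> d y a < \<alpha> \<and> (\<forall>F\<subseteq>{..<k}. F \<noteq> {} \<longrightarrow> \<beta> \<le> d y ((f ^^ sum s F) a))" for k
  proof -
    obtain n j where j: "j \<in> E n" "\<forall>F\<subseteq>{..<k}. j + sum s F \<in> E n" using sums[of k] by blast
    obtain a where a: "a \<in> M" "d y a < \<alpha>" "\<forall>i\<in>E n. j < i \<longrightarrow> \<beta> \<le> d y ((f ^^ (i - j)) a)"
      using escape[OF j(1)] by blast
    have "\<beta> \<le> d y ((f ^^ sum s F) a)" if F: "F \<subseteq> {..<k}" "F \<noteq> {}" for F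
    proof -
      have "finite F" using F(1) finite_subset by blast
      then have "0 < sum s F" using F(2) s by (intro sum_pos) auto
      moreover have "j + sum s F \<in> E n" using j(2) F(1) by blast
      ultimately show ?thesis using a(3)[rule_format, of "j + sum s F"] by simp
    qed
    then show ?thesis using a by blast
  qed
  then obtain a where a: "\<And>k. a k \<in> M" "\<And>k. d y (a k) < \<alpha>"
    and far: "\<And>k F. F \<subseteq> {..<k} \<Longrightarrow> F \<noteq> {} \<Longrightarrow> \<beta> \<le> d y ((f ^^ sum s F) (a k))" by metis
  obtain l r where l: "l \<in> M" and r: "strict_mono r"
    and lim: "limitin mtopology (a \<circ> r) l sequentially"
    using compact a(1) unfolding compact_space_sequentially by (metis image_subsetI)
  \<comment> \<open>Three errors are to fit between \<open>\<alpha>\<close> and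
    \<open>\<beta>\<close>: from \<open>a (r k)\<close> to \<open>l\<close>, from \<open>l\<close>
    to its image, and between the images.\<close>
  define \<eta> where "\<eta> = (\<beta> - \<alpha>) / 3"
  have "\<eta> > 0" using \<open>\<alpha> < \<beta>\<close> by (simp add: \<eta>_def)
  obtain t where t: "t \<in> finite_sums s 0" "d ((f ^^ t) l) l < \<eta>"
    using distal_finite_sums_recurrent[OF compact cont inj distal l \<open>\<eta> > 0\<close>] by blast
  obtain F where F: "finite F" "F \<noteq> {}" "t = sum s F" using t(1) by (auto simp: finite_sums_def)
  obtain K where K: "F \<subseteq> {..<K}" using finite_nat_bounded[OF F(1)] by blast
  have cont_t: "continuous_map mtopology mtopology (f ^^ t)" for t
    by (induction t) (use continuous_map_compose[OF _ cont] in \<open>auto simp: o_def\<close>)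
  have M: "(f ^^ t) z \<in> M" if "z \<in> M" for z
    using cont_t[of t] that by (auto simp: continuous_map_def)
  have "limitin mtopology ((f ^^ t) \<circ> (a \<circ> r)) ((f ^^ t) l) sequentially"
    by (rule continuous_map_limit[OF cont_t lim])
  then have "\<forall>\<^sub>F k in sequentially. d ((f ^^ t) (a (r k))) ((f ^^ t) l) < \<eta>"
    using \<open>\<eta> > 0\<close> unfolding limitin_metric by (auto elim!: allE[of _ \<eta>] eventually_mono)
  moreover have "\<forall>\<^sub>F k in sequentially. d (a (r k)) l < \<eta>"
    using lim \<open>\<eta> > 0\<close> unfolding limitin_metric by (auto elim!: allE[of _ \<eta>] eventually_mono)
  moreover have "\<forall>\<^sub>F k in sequentially. K \<le> k" by (rule eventually_ge_at_top)
  ultimately have "\<forall>\<^sub>F k in sequentially. d ((f ^^ t) (a (r k))) ((f ^^ t) l) < \<eta> \<and>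
      d (a (r k)) l < \<eta> \<and> K \<le> k" by eventually_elim blast
  then obtain k where k: "d ((f ^^ t) (a (r k))) ((f ^^ t) l) < \<eta>" "d (a (r k)) l < \<eta>" "K \<le> k"
    by (auto simp: eventually_sequentially)
  have "F \<subseteq> {..<r k}" using K k(3) seq_suble[OF r, of k] by force
  then have "\<beta> \<le> d y ((f ^^ t) (a (r k)))" using far[of F "r k"] F by simp
  also have "\<dots> \<le> d y (a (r k)) + d (a (r k)) ((f ^^ t) (a (r k)))"
    using y a M by (intro triangle) auto
  also have "d (a (r k)) ((f ^^ t) (a (r k))) \<le> d (a (r k)) l + d l ((f ^^ t) (a (r k)))"
    using l a M by (intro triangle) auto
  also have "d l ((f ^^ t) (a (r k))) \<le> d l ((f ^^ t) l) + d ((f ^^ t) l) ((f ^^ t) (a (r k)))"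
    using l a M by (intro triangle) auto
  finally have "\<beta> \<le> d y (a (r k)) + (d (a (r k)) l + (d l ((f ^^ t) l) + d ((f ^^ t) l) ((f ^^ t) (a (r k)))))"
    by simp
  also have "\<dots> < \<alpha> + (\<eta> + (\<eta> + \<eta>))"
    using a(2)[of "r k"] k t(2) by (simp add: commute)
  also have "\<dots> = \<beta>" by (simp add: \<eta>_def field_simps)
  finally show False by simp
qed

lemma hyperspace_subset: "A \<in> hyperspace M d \<Longrightarrow> A \<noteq> {} \<and> A \<subseteq> M"
  unfolding hyperspace_def using closedin_subset by fastforce

lemma funpow_induced_map: "(induced_map f ^^ n) A = (f ^^ n) ` A"
  by (induction n) (auto simp: induced_map_def image_image)

lemma bdd_below_dist: "bdd_below (d x ` A)"
  by (auto intro: bdd_belowI[of _ 0])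

lemma hausdorff_dist_greater:
  assumes "\<epsilon> < hausdorff_dist d A B" "A \<noteq> {}" "B \<noteq> {}"
  shows "(\<exists>x\<in>A. \<epsilon> < (INF b\<in>B. d x b)) \<or> (\<exists>y\<in>B. \<epsilon> < (INF a\<in>A. d y a))"
proof (rule ccontr)
  assume "\<not> ?thesis"
  then have "(SUP x\<in>A. INF b\<in>B. d x b) \<le> \<epsilon>" "(SUP y\<in>B. INF a\<in>A. d y a) \<le> \<epsilon>"
    using assms by (auto intro!: cSUP_least simp: not_less)
  then show False using assms(1) by (simp add: hausdorff_dist_def)
qed

text \<open>Replacing \<open>x\<close> by a net point \<open>y\<close> costs less than
  \<open>r\<close> on either side, which leaves a gap between \<open>r\<close> and
  \<open>2 * r\<close>.\<close>

lemma separated_detected_by_net: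
  assumes y: "y \<in> M" "d y x < r" and x: "x \<in> A" and AB: "A \<subseteq> M" "B \<subseteq> M" "B \<noteq> {}"
    and "3 * r < (INF b\<in>B. d x b)"
  shows "(INF a\<in>A. d y a) < r" "2 * r \<le> (INF b\<in>B. d y b)"
proof -
  show "(INF a\<in>A. d y a) < r"
    using cINF_lower[OF bdd_below_dist x, of y] y(2) by linarith
  show "2 * r \<le> (INF b\<in>B. d y b)"
  proof (rule cINF_greatest[OF AB(3)])
    fix b assume b: "b \<in> B"
    have "3 * r < d x b" using cINF_lower[OF bdd_below_dist b, of x] assms(7) by linarith
    also have "\<dots> \<le> d x y + d y b" using x y b AB by (intro triangle) auto
    finally show "2 * r \<le> d y b" using y(2) by (simp add: commute)
  qed
qed

text \<open>Otherwise, for infinitely many \<open>n\<close>, the \<open>m * n\<close> tests (net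
  point, time) would have a staircase of length linear in \<open>n\<close>. Fixing its net point and
  its gap leaves a dense family of times, which distality excludes.\<close>

lemma hyperspace_separated_subexponential:
  assumes compact: "compact_space mtopology" and cont: "continuous_map mtopology mtopology f"
    and inj: "inj_on f M" and distal: "distal_on M d f" and "\<epsilon> > 0" "h > 0"
  shows "\<forall>\<^sub>F n in sequentially. \<forall>E. finite E \<and>
    bowen_separated (hyperspace M d) (hausdorff_dist d) (induced_map f) n \<epsilon> E \<longrightarrow>
    real (card E) \<le> exp (h * real n)"
proof (rule ccontr)
  assume not: "\<not> ?thesis"
  define bad where "bad n E \<longleftrightarrow> finite E \<and> exp (h * real n) < real (card E) \<and>
    bowen_separated (hyperspace M d) (hausdorff_dist d) (induced_map f) n \<epsilon> E" for n E
  have freq: "\<exists>\<^sub>F n in sequentially. \<exists>E. bad n E"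
    using not unfolding not_eventually bad_def by (rule frequently_elim1) (auto simp: not_le)
  have M: "(f ^^ t) ` A \<subseteq> M" if "A \<subseteq> M" for t A
    using that cont by (induction t) (auto simp: continuous_map_def)
  define r where "r = \<epsilon> / 3"
  have r: "r > 0" using \<open>\<epsilon> > 0\<close> by (simp add: r_def)
  obtain Y where Y: "finite Y" "Y \<subseteq> M" "M \<subseteq> (\<Union>x\<in>Y. mball x r)"
    using compactin_imp_mtotally_bounded[of M] compact r
    unfolding mtotally_bounded_def compact_space_def by auto
  define m where "m = card Y"
  obtain y :: "nat \<Rightarrow> 'a" where y: "y ` {..<m} = Y"
    using ex_bij_betw_nat_finite[OF Y(1)] unfolding m_def bij_betw_def by (metis lessThan_atLeast0)
  have "m > 0"
  proof -
    obtain n E where "bad n E" using frequently_ex[OF freq] by blast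
    then have "E \<subseteq> hyperspace M d" "E \<noteq> {}"
      by (auto simp: bad_def bowen_separated_def not_less)
    then have "M \<noteq> {}" using hyperspace_subset by blast
    then show ?thesis using Y by (auto simp: m_def card_gt_0_iff)
  qed
  \<comment> \<open>Makes \<open>(1 + 1/q) ^ (2 * m * n)\<close> at most
    \<open>exp (h * n / 2)\<close>, half of the exponent available.\<close>
  define q where "q = Suc (nat \<lceil>4 * real m / h\<rceil>)"
  have q: "q \<ge> 1" "4 * real m \<le> h * real q"
  proof -
    have "4 * real m / h \<le> real q" unfolding q_def by linarith
    then show "4 * real m \<le> h * real q" using \<open>h > 0\<close> by (simp add: field_simps)
  qed (simp add: q_def)
  \<comment> \<open>The levels run from \<open>\<theta> 0 = r\<close> to
    \<open>\<theta> (q + 2) = 2 * r\<close>, so a set nearer than \<open>r\<close> has test value 0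
    and one at distance at least \<open>2 * r\<close> has a value above
    \<open>Suc q\<close>.\<close>
  define \<theta> where "\<theta> c = r + real c * r / (real q + 2)" for c :: nat
  define \<rho> where "\<rho> t l A = (INF a\<in>(f ^^ t) ` A. d (y l) a)" for t l A
  \<comment> \<open>Test \<open>t * m + l\<close> is the distance of \<open>y l\<close> to \<open>(f ^^ t) ` A\<close>, in steps of \<open>r / (q + 2)\<close> above \<open>r\<close>.\<close>
  define v where "v i A = nat \<lfloor>(\<rho> (i div m) (i mod m) A - r) * (real q + 2) / r\<rfloor>" for i A
  have v_less: "\<rho> (i div m) (i mod m) A < \<theta> c" if "v i A < c" for i A c
  proof -
    have "(\<rho> (i div m) (i mod m) A - r) * (real q + 2) / r < real c"
      using that unfolding v_def by linarith
    then show ?thesis using r by (simp add: \<theta>_def field_simps)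
  qed
  \<comment> \<open>Discarding the value \<open>c\<close> thus leaves a whole step between
    \<open>\<theta> c\<close> and \<open>\<theta> (Suc c)\<close>, with a width independent of
    \<open>n\<close>.\<close>
  have v_greater: "\<theta> (Suc c) \<le> \<rho> (i div m) (i mod m) A" if "c < v i A" for i A c
  proof -
    have "real (Suc c) \<le> (\<rho> (i div m) (i mod m) A - r) * (real q + 2) / r"
      using that unfolding v_def by linarith
    then show ?thesis using r by (simp add: \<theta>_def field_simps)
  qed
  have separated: "\<exists>i<m * n. v i A = 0 \<and> v i B > Suc q \<or> v i B = 0 \<and> v i A > Suc q"
    if E: "bad n E" "A \<in> E" "B \<in> E" "A \<noteq> B" for n E A B
  proof -
    have "\<exists>t<n. \<epsilon> < hausdorff_dist d ((f ^^ t) ` A) ((f ^^ t) ` B)"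
      using E by (simp add: bad_def bowen_separated_def funpow_induced_map)
    then obtain t where t: "t < n" "\<epsilon> < hausdorff_dist d ((f ^^ t) ` A) ((f ^^ t) ` B)" by blast
    have AB: "A \<noteq> {}" "A \<subseteq> M" "B \<noteq> {}" "B \<subseteq> M"
      using E hyperspace_subset[of A] hyperspace_subset[of B]
      by (auto simp: bad_def bowen_separated_def)
    have detect: "\<exists>i<m * n. v i A = 0 \<and> v i B > Suc q"
      if x: "x \<in> (f ^^ t) ` A" "\<epsilon> < (INF b\<in>(f ^^ t) ` B. d x b)" "A \<subseteq> M" "B \<subseteq> M" "B \<noteq> {}" for x A B
    proof -
      have "x \<in> M" using x(1) M[OF x(3), of t] by blast
      then obtain z where "z \<in> Y" and z: "z \<in> M" "d z x < r" using Y(3) by auto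
      then obtain l where "l < m" "z = y l" using y by blast
      with z have l: "l < m" "y l \<in> M" "d (y l) x < r" by auto
      have "\<rho> t l A < r" "2 * r \<le> \<rho> t l B"
        unfolding \<rho>_def
        using separated_detected_by_net[OF l(2,3) x(1) M[OF x(3)] M[OF x(4)]] x(2,5)
        by (auto simp: r_def)
      then have "(\<rho> t l A - r) * (real q + 2) \<le> 0" "r * (real q + 2) \<le> (\<rho> t l B - r) * (real q + 2)"
        by (intro mult_nonpos_nonneg mult_right_mono; simp)+
      then have "(\<rho> t l A - r) * (real q + 2) / r \<le> 0"
        "real q + 2 \<le> (\<rho> t l B - r) * (real q + 2) / r"
        using r by (simp_all add: divide_le_0_iff pos_le_divide_eq mult.commute)
      moreover define i where "i = t * m + l"
      have i: "i div m = t" "i mod m = l" using l(1) by (auto simp: i_def)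
      ultimately have "v i A = 0" "v i B > Suc q" unfolding v_def i by linarith+
      moreover have "i < m * n"
      proof -
        have "i < (t + 1) * m" using l(1) by (simp add: i_def)
        also have "\<dots> \<le> n * m" using t(1) by (intro mult_le_mono1) simp
        finally show ?thesis by (simp add: mult.commute)
      qed
      ultimately show ?thesis by blast
    qed
    show ?thesis
      using hausdorff_dist_greater[OF t(2)] detect AB by (metis image_is_empty)
  qed
  \<comment> \<open>Linear in \<open>n\<close>, yet \<open>q ^ K n\<close> is at most
    \<open>exp (q * K n)\<close> and so uses at most the other half of the exponent.\<close>
  define K where "K n = nat \<lfloor>h * real n / (2 * real q)\<rfloor>" for n
  \<comment> \<open>The size is demanded only where a bad family exists; elsewhere the empty
    \<open>J\<close> serves, so that a choice is possible for every \<open>n\<close>.\<close>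
  define staircase where "staircase n J c w \<longleftrightarrow>
      J \<subseteq> {..<m * n} \<and> ((\<exists>E. bad n E) \<longrightarrow> card J = K n) \<and>
      (\<forall>j\<in>J. c j \<in> {1..Suc q} \<and> w j \<in> hyperspace M d \<and> v j (w j) < c j \<and>
        (\<forall>i\<in>J. j < i \<longrightarrow> c i < v i (w j)))" for n J c w
  have "\<exists>J c w. staircase n J c w" for n
  proof (cases "\<exists>E. bad n E")
    case False
    then show ?thesis unfolding staircase_def by (intro exI[of _ "{}"]) blast
  next
    case True
    then obtain E where E: "bad n E" by blast
    have qK: "real q * real (K n) \<le> h * real n / 2"
    proof -
      have "real (K n) \<le> h * real n / (2 * real q)" using \<open>h > 0\<close> by (simp add: K_def)
      then show ?thesis using q by (simp add: field_simps)
    qed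
    have "(1 + 1 / real q) ^ (2 * (m * n)) \<le> exp (1 / real q) ^ (2 * (m * n))"
      by (intro power_mono exp_ge_add_one_self) simp
    also have "\<dots> = exp (2 * real m * real n / real q)" by (simp add: exp_of_nat_mult[symmetric])
    also have "\<dots> \<le> exp (h * real n / 2)"
    proof -
      have "4 * real m * real n \<le> h * real q * real n" using q(2) by (intro mult_right_mono) auto
      then show ?thesis using q(1) by (simp add: field_simps)
    qed
    finally have 1: "(1 + 1 / real q) ^ (2 * (m * n)) \<le> exp (h * real n / 2)" .
    have "real q \<le> exp (real q)" using exp_ge_add_one_self[of "real q"] by linarith
    then have "real q ^ K n \<le> exp (real q) ^ K n" by (intro power_mono) auto
    also have "\<dots> = exp (real q * real (K n))" by (simp add: exp_of_nat_mult[symmetric] mult.commute)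
    also have "\<dots> \<le> exp (h * real n / 2)" using qK by simp
    finally have "real q ^ K n \<le> exp (h * real n / 2)" .
    with 1 have "(1 + 1 / real q) ^ (2 * (m * n)) * real q ^ K n \<le> exp (h * real n / 2) * exp (h * real n / 2)"
      by (intro mult_mono) auto
    also have "\<dots> = exp (h * real n)" by (simp add: exp_add[symmetric])
    also have "\<dots> < card E" using E by (simp add: bad_def)
    finally have "\<exists>J c w. J \<subseteq> {..<m * n} \<and> card J = K n \<and>
      (\<forall>j\<in>J. c j \<in> {1..Suc q} \<and> w j \<in> E \<and> v j (w j) < c j \<and> (\<forall>i\<in>J. j < i \<longrightarrow> c i < v i (w j)))"
      using separated[OF E] E q(1) by (intro separated_family_staircase) (auto simp: bad_def)
    moreover have "E \<subseteq> hyperspace M d" using E by (simp add: bad_def bowen_separated_def)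
    ultimately show ?thesis unfolding staircase_def by blast
  qed
  then obtain J c w where stair: "\<And>n. staircase n (J n) (c n) (w n)" by metis
  have J: "\<And>n. J n \<subseteq> {..<m * n}" "\<And>n E. bad n E \<Longrightarrow> card (J n) = K n"
    and c: "\<And>n j. j \<in> J n \<Longrightarrow> c n j \<in> {1..Suc q}"
    and w: "\<And>n j. j \<in> J n \<Longrightarrow> w n j \<in> hyperspace M d"
    and below: "\<And>n j. j \<in> J n \<Longrightarrow> v j (w n j) < c n j"
    and above: "\<And>n i j. j \<in> J n \<Longrightarrow> i \<in> J n \<Longrightarrow> j < i \<Longrightarrow> c n i < v i (w n j)"
    using stair unfolding staircase_def by blast+
  define I where "I = {..<m} \<times> {1..Suc q}"
  define T where "T s n = {t. t * m + fst s \<in> J n \<and> c n (t * m + fst s) = snd s}" for s n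
  \<comment> \<open>The density \<open>h / (4 * q)\<close> is half the rate of \<open>K n\<close>;
    the other half absorbs the rounding for large \<open>n\<close>.\<close>
  have "\<exists>s\<in>I. frequently_dense (T s)"
  proof (rule frequently_dense_pigeonhole[where \<delta> = "h / (4 * real q)"])
    show "finite I" unfolding I_def by blast
    show "h / (4 * real q) > 0" using \<open>h > 0\<close> q(1) by simp
    show "\<exists>\<^sub>F n in sequentially. h / (4 * real q) * real n \<le> (\<Sum>s\<in>I. real (card (T s n \<inter> {..<n})))"
    proof (rule frequently_elim1[OF frequently_eventually_conj[OF freq eventually_ge_at_top]])
      fix n assume "nat \<lceil>4 * real q / h\<rceil> \<le> n \<and> (\<exists>E. bad n E)"
      then have "nat \<lceil>4 * real q / h\<rceil> \<le> n" and card_J: "card (J n) = K n" using J(2) by auto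
      then have "4 * real q / h \<le> real n" by linarith
      then have "1 \<le> h / (4 * real q) * real n" using \<open>h > 0\<close> q(1) by (simp add: field_simps)
      moreover have "h * real n / (2 * real q) - 1 \<le> real (K n)" unfolding K_def by linarith
      moreover have "h * real n / (2 * real q) = 2 * (h / (4 * real q) * real n)" by simp
      ultimately have "h / (4 * real q) * real n \<le> real (card (J n))"
        unfolding card_J by linarith
      also have "card (J n) \<le> card (\<Union>s\<in>I. (\<lambda>t. t * m + fst s) ` (T s n \<inter> {..<n}))"
      proof (rule card_mono)
        show "J n \<subseteq> (\<Union>s\<in>I. (\<lambda>t. t * m + fst s) ` (T s n \<inter> {..<n}))"
        proof
          fix j assume j: "j \<in> J n"
          have "j < n * m" using j J(1)[of n] by (auto simp: mult.commute)
          then have "j div m < n" by (rule less_mult_imp_div_less)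
          then have "j div m \<in> T (j mod m, c n j) n \<inter> {..<n}" using j by (simp add: T_def)
          moreover have "(j mod m, c n j) \<in> I" using c[OF j] \<open>m > 0\<close> by (simp add: I_def)
          ultimately show "j \<in> (\<Union>s\<in>I. (\<lambda>t. t * m + fst s) ` (T s n \<inter> {..<n}))"
            by (intro UN_I[of "(j mod m, c n j)"] image_eqI[of _ _ "j div m"]) auto
        qed
      qed (simp add: I_def)
      also have "\<dots> \<le> (\<Sum>s\<in>I. card ((\<lambda>t. t * m + fst s) ` (T s n \<inter> {..<n})))"
        by (rule card_UN_le) (simp add: I_def)
      also have "\<dots> \<le> (\<Sum>s\<in>I. card (T s n \<inter> {..<n}))" by (intro sum_mono card_image_le) simp
      finally show "h / (4 * real q) * real n \<le> (\<Sum>s\<in>I. real (card (T s n \<inter> {..<n})))" by simp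
    qed
  qed
  then obtain l c0 where l: "l < m" and dense: "frequently_dense (T (l, c0))" by (auto simp: I_def)
  show False
  proof (rule distal_no_frequently_dense[OF compact cont inj distal _ _ dense])
    show "y l \<in> M" using l y Y by blast
    show "\<theta> c0 < \<theta> (Suc c0)" using r by (simp add: \<theta>_def divide_strict_right_mono)
    fix n t assume t: "t \<in> T (l, c0) n"
    define j where "j = t * m + l"
    have j: "j \<in> J n" "c n j = c0" "j div m = t" "j mod m = l" using t l by (auto simp: T_def j_def)
    have W: "w n j \<noteq> {}" "w n j \<subseteq> M" using hyperspace_subset[OF w[OF j(1)]] by auto
    have "\<rho> t l (w n j) < \<theta> c0" using v_less[OF below[OF j(1)]] j by simp
    \<comment> \<open>The infimum need not be attained, but its strict bound gives a point
      \<open>a\<close>; the escaping point is \<open>(f ^^ t) a\<close>.\<close>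
    then obtain a where a: "a \<in> w n j" "d (y l) ((f ^^ t) a) < \<theta> c0"
      using W(1) unfolding \<rho>_def by (subst (asm) cINF_less_iff) (auto intro: bdd_below_dist)
    have "\<theta> (Suc c0) \<le> d (y l) ((f ^^ (u - t)) ((f ^^ t) a))" if u: "u \<in> T (l, c0) n" "t < u" for u
    proof -
      define i where "i = u * m + l"
      have i: "i \<in> J n" "c n i = c0" "i div m = u" "i mod m = l" using u l by (auto simp: T_def i_def)
      \<comment> \<open>For a fixed net point, tests are ordered as their times are.\<close>
      have "j < i" using u(2) \<open>m > 0\<close> by (simp add: i_def j_def)
      then have "\<theta> (Suc c0) \<le> \<rho> u l (w n j)" using v_greater[OF above[OF j(1) i(1)]] i by simp
      also have "\<dots> \<le> d (y l) ((f ^^ u) a)"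
        unfolding \<rho>_def using a(1) by (intro cINF_lower bdd_below_dist) auto
      also have "(f ^^ u) a = (f ^^ (u - t)) ((f ^^ t) a)"
        using u(2) funpow_add[of "u - t" t f] by simp
      finally show ?thesis .
    qed
    then show "\<exists>b\<in>M. d (y l) b < \<theta> c0 \<and> (\<forall>u\<in>T (l, c0) n. t < u \<longrightarrow>
        \<theta> (Suc c0) \<le> d (y l) ((f ^^ (u - t)) b))"
      using a M[OF W(2), of t] by (intro bexI[of _ "(f ^^ t) a"]) auto
  qed
qed

end

section \<open>From subexponential counting to zero entropy\<close>

lemma entropy_at_scale_nonneg: "0 \<le> entropy_at_scale X d f \<epsilon>"
proof -
  have "0 \<le> log_separated X d f n \<epsilon>" for n
    unfolding log_separated_def
    \<comment> \<open>The empty set is separated and contributes \<open>ln 0 = 0\<close>.\<close>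
    by (rule SUP_upper2[of "{}"]) (auto simp: bowen_separated_def)
  then have "0 \<le> log_separated X d f n \<epsilon> / ereal (real n)" for n
    unfolding divide_ereal_def by (intro ereal_0_le_mult) auto
  then show ?thesis
    unfolding entropy_at_scale_def by (intro le_Limsup always_eventually) auto
qed

lemma entropy_at_scale_eq_0:
  assumes "\<And>h. h > 0 \<Longrightarrow> \<forall>\<^sub>F n in sequentially. \<forall>E. finite E \<and> bowen_separated X d f n \<epsilon> E \<longrightarrow>
    real (card E) \<le> exp (h * real n)"
  shows "entropy_at_scale X d f \<epsilon> = 0"
proof -
  have "entropy_at_scale X d f \<epsilon> \<le> ereal h" if "h > 0" for h
    unfolding entropy_at_scale_def
  proof (rule Limsup_bounded)
    show "\<forall>\<^sub>F n in sequentially. log_separated X d f n \<epsilon> / ereal (real n) \<le> ereal h"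
      using assms[OF that] eventually_gt_at_top[of 0]
    proof eventually_elim
      case (elim n)
      have "ln (real (card E)) \<le> h * real n" if "finite E" "bowen_separated X d f n \<epsilon> E" for E
      \<comment> \<open>Monotonicity of \<open>ln\<close> needs a positive argument; for empty
        \<open>E\<close> the value is 0 by convention.\<close>
      proof (cases "card E = 0")
        case False
        have "ln (real (card E)) \<le> ln (exp (h * real n))"
          using elim(1) that False by (subst ln_le_cancel_iff) auto
        then show ?thesis by simp
      qed (use \<open>h > 0\<close> in simp)
      then have "log_separated X d f n \<epsilon> \<le> ereal (h * real n)"
        unfolding log_separated_def by (intro SUP_least) auto
      then have "log_separated X d f n \<epsilon> / ereal (real n) \<le> ereal (h * real n) / ereal (real n)"
        using elim(2) by (intro ereal_divide_right_mono) auto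
      then show ?case using elim(2) by simp
    qed
  qed
  then have "entropy_at_scale X d f \<epsilon> \<le> 0"
    by - (rule ereal_le_epsilon2, auto)
  then show ?thesis using entropy_at_scale_nonneg by (intro antisym)
qed

theorem theorem2p1:
  fixes X :: "'a set" and d :: "'a \<Rightarrow> 'a \<Rightarrow> real" and f :: "'a \<Rightarrow> 'a"
  assumes "Metric_space X d"
    and "compact_space (Metric_space.mtopology X d)"
    and "homeomorphic_map (Metric_space.mtopology X d) (Metric_space.mtopology X d) f"
    and "distal_on X d f"
  shows "topological_entropy (hyperspace X d) (hausdorff_dist d) (induced_map f) = 0"
proof -
  interpret Metric_space X d by fact
  let ?S = "entropy_at_scale (hyperspace X d) (hausdorff_dist d) (induced_map f)"
  have cont: "continuous_map mtopology mtopology f"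
    using assms(3) by (rule homeomorphic_imp_continuous_map)
  have inj: "inj_on f X" using homeomorphic_imp_injective_map[OF assms(3)] by simp
  have "?S \<epsilon> = 0" if "\<epsilon> > 0" for \<epsilon>
    by (intro entropy_at_scale_eq_0 hyperspace_separated_subexponential assms cont inj that)
  then have "\<forall>\<^sub>F \<epsilon> in at_right 0. ?S \<epsilon> = 0"
    by (auto simp: eventually_at_right_field intro: exI[of _ 1])
  then have "(?S \<longlongrightarrow> 0) (at_right 0)"
    by (rule tendsto_eventually)
  then show ?thesis
    by (rule tendsto_unique[OF trivial_limit_at_right_real tendsto_topological_entropy])
qed

end
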